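(* Let $(\Omega,\mathcal{F},P)$, $(X_n)_{n\ge1}$, $(\Theta,\mathcal{T})$, $\Pi_0$, $R_n$, $h$ and $\Pi_n$ be as in the context, and suppose that the three assumptions (i), (ii), (iii) listed in the context hold. Let $A\in\mathcal{T}$ be such that $\Pi_0(A)>0$ and $h(A)>h(\Theta)$. Then $$\Pi_n(A)\longrightarrow 0\quad\text{in } P\text{-probability as } n\to\infty .$$
   Context: $X_1,X_2,\dots$ is a sequence of random variables on a probability space $(\Omega,\mathcal{F},P)$ with values in a measurable space $(\Xi,\mathcal{X})$; $X_1^n=(X_1,\dots,X_n)$ and $\sigma(X_1^n)$ is the $\sigma$-field it generates. Expectations $\operatorname{E}$ are with respect to $P$. $\Pi_0$ is a (prior) probability measure on a measurable space $(\Theta,\mathcal{T})$. For each $n\in\mathbb{N}$ and $\theta\in\Theta$, a proxy model is given by $R_n(\theta,\omega)=f_\theta(X_1^n(\omega))$, a function on $\Theta\times\Omega$ (the functions $f_\theta$ need not be probability densities). $R_n(\theta)$ denotes the random variable $\omega\mapsto R_n(\theta,\omega)$. The (pseudo-)posterior is $$\Pi_n(A)=\frac{\int_A R_n(\theta,\omega)\,\Pi_0(d\theta)}{\int_\Theta R_n(\theta,\omega)\,\Pi_0(d\theta)},\quad A\in\mathcal{T}.$$ Assumptions: (i) For each $n\in\mathbb{N}$, $R_n(\theta,\omega)$ is positive, $\mathcal{T}\otimes\sigma(X_1^n)$-measurable, and $0<\int_\Theta R_n(\theta,\omega)\,\Pi_0(d\theta)<\infty$ $P$-a.s. (ii) For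 each $\theta\in\Theta$ and $n\in\mathbb{N}$, $\operatorname{E}|\ln R_n(\theta)|<\infty$, and $h(\theta):=-\lim_{n\to\infty}\frac1n\operatorname{E}(\ln R_n(\theta))$ exists (as a real number) pointwise in $\theta$, with $h$ being $\mathcal{T}$-measurable. Moreover $|h(\Theta)|<\infty$, where for $A\in\mathcal{T}$, $h(A)$ denotes the essential infimum of $h$ on $A$ with respect to $\Pi_0$. (iii) As a function of $\omega$, $\sup_{\theta\in\Theta}\left|\frac1n\ln R_n(\theta,\omega)+h(\theta)\right|$ is $\sigma(X_1^n)$-measurable, and it converges to $0$ in $P$-probability as $n\to\infty$. *)

theory Defs
  imports "HOL-Probability.Probability"
begin

text \<open>Indices start at \<open>1\<close>: a segment \<open>(X\<^sub>1, \<dots>, X\<^sub>n)\<close> is an element of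
  \<^term>\<open>space (PiM {1..n} (\<lambda>_. Xi))\<close>, i.e. an extensional function on \<^term>\<open>{1..n::nat}\<close>.\<close>

definition init_seg :: "(nat \<Rightarrow> 'w \<Rightarrow> 'x) \<Rightarrow> nat \<Rightarrow> 'w \<Rightarrow> (nat \<Rightarrow> 'x)" where
  "init_seg X n \<omega> = (\<lambda>i\<in>{1..n}. X i \<omega>)"

text \<open>Only the \<open>\<sigma>\<close>-algebra of this measure is meaningful; the measure it carries is
  immaterial.\<close>

definition sigma_seg :: "'w measure \<Rightarrow> 'x measure \<Rightarrow> (nat \<Rightarrow> 'w \<Rightarrow> 'x) \<Rightarrow> nat \<Rightarrow> 'w measure" where
  "sigma_seg P Xi X n = vimage_algebra (space P) (init_seg X n) (PiM {1..n} (\<lambda>_. Xi))"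

definition ess_inf_on :: "'t measure \<Rightarrow> 't set \<Rightarrow> ('t \<Rightarrow> real) \<Rightarrow> ereal" where
  "ess_inf_on M A h = Sup {a :: ereal. AE \<theta> in M. \<theta> \<in> A \<longrightarrow> a \<le> ereal (h \<theta>)}"

lemma ess_inf_on_eq_esssup:
  assumes A: "A \<in> sets M" and h: "h \<in> borel_measurable M"
  shows "ess_inf_on M A h = - esssup (restrict_space M A) (\<lambda>\<theta>. - ereal (h \<theta>))"
proof -
  have m: "(\<lambda>\<theta>. - ereal (h \<theta>)) \<in> borel_measurable (restrict_space M A)"
    using h by (intro measurable_restrict_space1) simp
  have A': "A \<inter> space M \<in> sets M"
    using A by simp
  have flip: "- ereal x \<le> z \<longleftrightarrow> - z \<le> ereal x" for x z
    by (cases z) auto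
  have ae: "(AE \<theta> in restrict_space M A. - ereal (h \<theta>) \<le> z)
      \<longleftrightarrow> (AE \<theta> in M. \<theta> \<in> A \<longrightarrow> - z \<le> ereal (h \<theta>))" for z :: ereal
    using A' by (simp only: AE_restrict_space_iff[OF A'] flip)
  let ?S = "{a. AE \<theta> in M. \<theta> \<in> A \<longrightarrow> a \<le> ereal (h \<theta>)}"
  have "{z. AE \<theta> in M. \<theta> \<in> A \<longrightarrow> - z \<le> ereal (h \<theta>)} = uminus ` ?S"
  proof (intro set_eqI iffI)
    fix z assume "z \<in> {z. AE \<theta> in M. \<theta> \<in> A \<longrightarrow> - z \<le> ereal (h \<theta>)}"
    then have "- z \<in> ?S" by simp
    then show "z \<in> uminus ` ?S" by (intro image_eqI[where x = "- z"]) simp_all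
  qed auto
  moreover have "Inf (uminus ` ?S) = - Sup ?S"
    by (rule ereal_Inf_uminus_image_eq)
  ultimately show ?thesis
    unfolding ess_inf_on_def esssup_eq_AE[OF m] ae by simp
qed

text \<open>The numerator and the denominator are Lebesgue integrals of a positive function, hence
  taken in \<open>[0, \<infinity>]\<close>. The value on outcomes where the denominator is \<open>0\<close> or \<open>\<infinity>\<close> is the
  library's convention for division in \<^typ>\<open>ennreal\<close>.\<close>

definition posterior ::
    "'t measure \<Rightarrow> (nat \<Rightarrow> 't \<Rightarrow> 'w \<Rightarrow> real) \<Rightarrow> nat \<Rightarrow> 't set \<Rightarrow> 'w \<Rightarrow> ennreal" where
  "posterior Pi0 R n A \<omega> =
     (\<integral>\<^sup>+\<theta>\<in>A. ennreal (R n \<theta> \<omega>) \<partial>Pi0) / (\<integral>\<^sup>+\<theta>. ennreal (R n \<theta> \<omega>) \<partial>Pi0)"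

text \<open>Stated for \<open>[0, \<infinity>]\<close>-valued variables, so that it also covers suprema that may be infinite.\<close>

definition tendsto_zero_in_prob :: "'w measure \<Rightarrow> (nat \<Rightarrow> 'w \<Rightarrow> ennreal) \<Rightarrow> bool" where
  "tendsto_zero_in_prob P Y \<longleftrightarrow>
     (\<forall>\<epsilon>::real. \<epsilon> > 0 \<longrightarrow> (\<lambda>n. measure P {\<omega> \<in> space P. Y n \<omega> > ennreal \<epsilon>}) \<longlonglongrightarrow> 0)"

end

theory Submission
  imports Defs
begin

text \<open>If every \<open>\<bar>(1/n) ln R\<^sub>n(\<theta>) + h(\<theta>)\<bar>\<close> is at most \<open>\<delta>\<close>, then \<open>R\<^sub>n(\<theta>)\<close> lies between
  \<open>exp (- n (h(\<theta>) + \<delta>))\<close> and \<open>exp (- n (h(\<theta>) - \<delta>))\<close>. The gap between the essential infima leaves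
  room for reals \<open>a < b\<close> with \<open>h(\<Theta>) < a\<close> and \<open>b < h(A)\<close>. Almost everywhere on \<open>A\<close> one has \<open>h \<ge> b\<close>, so
  the numerator of the posterior is at most \<open>exp (- n (b - \<delta>))\<close>; the set \<open>B = {h < a}\<close> has positive
  prior mass, so the denominator is at least \<open>exp (- n (a + \<delta>)) \<Pi>\<^sub>0(B)\<close>. Hence
  \<open>\<Pi>\<^sub>n(A) \<le> exp (- n (b - a - 2 \<delta>)) / \<Pi>\<^sub>0(B)\<close> (lemma \<open>posterior_le_exp\<close>), and with
  \<open>\<delta> = (b - a) / 3\<close> the right-hand side is a deterministic null sequence. Thus, for every \<open>\<epsilon> > 0\<close>
  and all large \<open>n\<close>, the event \<open>\<Pi>\<^sub>n(A) > \<epsilon>\<close> is contained in the event that the supremum exceeds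
  \<open>\<delta>\<close>, whose probability vanishes by uniform convergence.\<close>

lemma ennreal_inverse_antimono:
  fixes x y :: ennreal
  shows "x \<le> y \<Longrightarrow> inverse y \<le> inverse x"
  including ennreal.lifting
  by transfer (rule ereal_inverse_antimono)

lemma AE_ge_of_less_ess_inf_on:
  fixes c :: ereal
  assumes "c < ess_inf_on M A h"
  shows "AE \<theta> in M. \<theta> \<in> A \<longrightarrow> c \<le> ereal (h \<theta>)"
proof -
  obtain d where "c < d" and "AE \<theta> in M. \<theta> \<in> A \<longrightarrow> d \<le> ereal (h \<theta>)"
    using assms unfolding ess_inf_on_def less_Sup_iff by auto
  then show ?thesis
    by (auto elim!: eventually_mono)
qed

lemma (in finite_measure) measure_pos_of_ess_inf_on_less:
  fixes a :: real
  assumes h: "h \<in> borel_measurable M" and less: "ess_inf_on M (space M) h < ereal a"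
  shows "measure M {\<theta> \<in> space M. h \<theta> < a} > 0"
proof (rule ccontr)
  let ?B = "{\<theta> \<in> space M. h \<theta> < a}"
  have B: "?B \<in> sets M"
    using h by measurable
  assume "\<not> measure M ?B > 0"
  then have "measure M ?B = 0"
    by (simp add: not_less measure_le_0_iff)
  then have "AE \<theta> in M. \<theta> \<notin> ?B"
    using B by (intro AE_not_in null_setsI) (simp_all add: emeasure_eq_measure)
  then have "AE \<theta> in M. \<theta> \<in> space M \<longrightarrow> ereal a \<le> ereal (h \<theta>)"
    by eventually_elim auto
  then have "ereal a \<le> ess_inf_on M (space M) h"
    unfolding ess_inf_on_def by (intro Sup_upper) simp
  with less show False
    by simp
qed

text \<open>Comparing probabilities of nested events needs the larger one to be an event of \<open>P\<close>, whereas the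
  supremum is only given as measurable with respect to the observed segment.\<close>

lemma borel_measurable_sigma_seg_imp:
  assumes X: "\<And>i. i \<ge> 1 \<Longrightarrow> X i \<in> measurable P Xi"
    and g: "g \<in> borel_measurable (sigma_seg P Xi X n)"
  shows "g \<in> borel_measurable P"
proof -
  have "init_seg X n \<in> measurable P (PiM {1..n} (\<lambda>_. Xi))"
    unfolding init_seg_def by (intro measurable_restrict X) simp
  then have "id \<in> measurable P (sigma_seg P Xi X n)"
    unfolding sigma_seg_def by (intro measurable_vimage_algebra2) (auto simp: measurable_space)
  from measurable_comp[OF this g] show ?thesis
    by simp
qed

text \<open>The factor \<open>b - a - 2 \<delta>\<close> arises because numerator and denominator each lose \<open>\<delta>\<close> when
  \<open>- n h(\<theta>)\<close> replaces \<open>ln R\<^sub>n(\<theta>)\<close>. The quotient is estimated in \<open>[0, \<infinity>]\<close>, where division is monotone,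
  so the bound also covers an infinite denominator.\<close>

lemma posterior_le_exp:
  assumes prior: "prob_space Pi0"
    and h: "h \<in> borel_measurable Pi0"
    and n: "n \<ge> 1"
    and pos: "\<And>\<theta>. \<theta> \<in> space Pi0 \<Longrightarrow> R n \<theta> \<omega> > 0"
    and approx: "\<And>\<theta>. \<theta> \<in> space Pi0 \<Longrightarrow> \<bar>1 / real n * ln (R n \<theta> \<omega>) + h \<theta>\<bar> \<le> \<delta>"
    and A_ge: "AE \<theta> in Pi0. \<theta> \<in> A \<longrightarrow> b \<le> h \<theta>"
    and B_pos: "measure Pi0 {\<theta> \<in> space Pi0. h \<theta> < a} > 0"
  shows "posterior Pi0 R n A \<omega>
    \<le> ennreal (exp (- (real n * (b - a - 2 * \<delta>))) / measure Pi0 {\<theta> \<in> space Pi0. h \<theta> < a})"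
proof -
  interpret prob_space Pi0 by fact
  let ?B = "{\<theta> \<in> space Pi0. h \<theta> < a}"
  have B: "?B \<in> sets Pi0"
    using h by measurable
  have ln_bounds: "- (real n * (h \<theta> + \<delta>)) \<le> ln (R n \<theta> \<omega>) \<and> ln (R n \<theta> \<omega>) \<le> - (real n * (h \<theta> - \<delta>))"
    if "\<theta> \<in> space Pi0" for \<theta>
  proof -
    have "real n * \<bar>1 / real n * ln (R n \<theta> \<omega>) + h \<theta>\<bar> \<le> real n * \<delta>"
      using approx[OF that] by (intro mult_left_mono) auto
    moreover have "real n * \<bar>1 / real n * ln (R n \<theta> \<omega>) + h \<theta>\<bar> = \<bar>ln (R n \<theta> \<omega>) + real n * h \<theta>\<bar>"
    proof -
      have "ln (R n \<theta> \<omega>) + real n * h \<theta> = real n * (1 / real n * ln (R n \<theta> \<omega>) + h \<theta>)"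
        using n by (simp add: distrib_left)
      then show ?thesis
        by (simp only: abs_mult abs_of_nat)
    qed
    ultimately show ?thesis
      by (auto simp: algebra_simps abs_le_iff)
  qed
  have "(\<integral>\<^sup>+\<theta>\<in>A. ennreal (R n \<theta> \<omega>) \<partial>Pi0) \<le> (\<integral>\<^sup>+\<theta>. ennreal (exp (- (real n * (b - \<delta>)))) \<partial>Pi0)"
  proof (rule nn_integral_mono_AE)
    show "AE \<theta> in Pi0. ennreal (R n \<theta> \<omega>) * indicator A \<theta> \<le> ennreal (exp (- (real n * (b - \<delta>))))"
      using A_ge AE_space
    proof eventually_elim
      case (elim \<theta>)
      have "R n \<theta> \<omega> \<le> exp (- (real n * (b - \<delta>)))" if "\<theta> \<in> A"
      proof -
        have "real n * (b - \<delta>) \<le> real n * (h \<theta> - \<delta>)"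
          using elim that by (intro mult_left_mono) auto
        then have "ln (R n \<theta> \<omega>) \<le> - (real n * (b - \<delta>))"
          using ln_bounds elim by force
        then show ?thesis
          using pos elim by (metis exp_le_cancel_iff exp_ln)
      qed
      then show ?case
        by (auto simp: indicator_def intro!: ennreal_leI)
    qed
  qed
  then have num: "(\<integral>\<^sup>+\<theta>\<in>A. ennreal (R n \<theta> \<omega>) \<partial>Pi0) \<le> ennreal (exp (- (real n * (b - \<delta>))))"
    by (simp add: emeasure_space_1)
  have "(\<integral>\<^sup>+\<theta>. ennreal (exp (- (real n * (a + \<delta>)))) * indicator ?B \<theta> \<partial>Pi0)
      \<le> (\<integral>\<^sup>+\<theta>. ennreal (R n \<theta> \<omega>) \<partial>Pi0)"
  proof (rule nn_integral_mono)
    fix \<theta> assume \<theta>: "\<theta> \<in> space Pi0"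
    have "exp (- (real n * (a + \<delta>))) \<le> R n \<theta> \<omega>" if "h \<theta> < a"
    proof -
      have "real n * (h \<theta> + \<delta>) \<le> real n * (a + \<delta>)"
        using that by (intro mult_left_mono) auto
      then have "- (real n * (a + \<delta>)) \<le> ln (R n \<theta> \<omega>)"
        using ln_bounds \<theta> by force
      then show ?thesis
        using pos \<theta> by (metis exp_le_cancel_iff exp_ln)
    qed
    then show "ennreal (exp (- (real n * (a + \<delta>)))) * indicator ?B \<theta> \<le> ennreal (R n \<theta> \<omega>)"
      by (auto simp: indicator_def intro!: ennreal_leI)
  qed
  then have den: "ennreal (exp (- (real n * (a + \<delta>))) * measure Pi0 ?B)
      \<le> (\<integral>\<^sup>+\<theta>. ennreal (R n \<theta> \<omega>) \<partial>Pi0)"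
    using B by (simp add: nn_integral_cmult_indicator emeasure_eq_measure ennreal_mult)
  have "posterior Pi0 R n A \<omega>
      \<le> ennreal (exp (- (real n * (b - \<delta>)))) / ennreal (exp (- (real n * (a + \<delta>))) * measure Pi0 ?B)"
    unfolding posterior_def divide_ennreal_def
    using num den by (intro mult_mono ennreal_inverse_antimono) auto
  also have "\<dots> = ennreal (exp (- (real n * (b - \<delta>))) / (exp (- (real n * (a + \<delta>))) * measure Pi0 ?B))"
    using B_pos by (intro divide_ennreal) auto
  also have "exp (- (real n * (b - \<delta>))) / (exp (- (real n * (a + \<delta>))) * measure Pi0 ?B)
      = exp (- (real n * (b - a - 2 * \<delta>))) / measure Pi0 ?B"
  proof -
    have "exp (- (real n * (b - \<delta>))) / exp (- (real n * (a + \<delta>))) = exp (- (real n * (b - a - 2 * \<delta>)))"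
      by (simp add: exp_diff[symmetric] algebra_simps)
    then show ?thesis
      by (simp only: divide_divide_eq_left[symmetric])
  qed
  finally show ?thesis .
qed

lemma tendsto_exp_neg_mult_real:
  fixes c :: real
  assumes "c > 0"
  shows "(\<lambda>n. exp (- (real n * c))) \<longlonglongrightarrow> 0"
proof -
  have "(\<lambda>n. exp (- c) ^ n) \<longlonglongrightarrow> 0"
    using assms by (intro LIMSEQ_realpow_zero) auto
  then show ?thesis
    by (simp add: exp_of_nat_mult[symmetric])
qed

theorem theorem2p1:
  fixes P :: "'w measure" and Xi :: "'x measure" and Pi0 :: "'t measure"
    and X :: "nat \<Rightarrow> 'w \<Rightarrow> 'x"
    and f :: "nat \<Rightarrow> 't \<Rightarrow> (nat \<Rightarrow> 'x) \<Rightarrow> real"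
    and R :: "nat \<Rightarrow> 't \<Rightarrow> 'w \<Rightarrow> real"
    and h :: "'t \<Rightarrow> real"
    and A :: "'t set"
  assumes prob_P: "prob_space P"
    and X_rv: "\<And>i. i \<ge> 1 \<Longrightarrow> X i \<in> measurable P Xi"
    and prior: "prob_space Pi0"
    and R_eq: "\<And>n \<theta> \<omega>. n \<ge> 1 \<Longrightarrow> \<theta> \<in> space Pi0 \<Longrightarrow> \<omega> \<in> space P \<Longrightarrow>
                 R n \<theta> \<omega> = f n \<theta> (init_seg X n \<omega>)"
    and i_pos: "\<And>n \<theta> \<omega>. n \<ge> 1 \<Longrightarrow> \<theta> \<in> space Pi0 \<Longrightarrow> \<omega> \<in> space P \<Longrightarrow> R n \<theta> \<omega> > 0"
    and i_meas: "\<And>n. n \<ge> 1 \<Longrightarrow>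
                 (\<lambda>(\<theta>, \<omega>). R n \<theta> \<omega>) \<in> borel_measurable (Pi0 \<Otimes>\<^sub>M sigma_seg P Xi X n)"
    and i_int: "\<And>n. n \<ge> 1 \<Longrightarrow> AE \<omega> in P.
                 0 < (\<integral>\<^sup>+\<theta>. ennreal (R n \<theta> \<omega>) \<partial>Pi0) \<and> (\<integral>\<^sup>+\<theta>. ennreal (R n \<theta> \<omega>) \<partial>Pi0) < \<infinity>"
    and ii_int: "\<And>n \<theta>. n \<ge> 1 \<Longrightarrow> \<theta> \<in> space Pi0 \<Longrightarrow> integrable P (\<lambda>\<omega>. ln (R n \<theta> \<omega>))"
    and ii_lim: "\<And>\<theta>. \<theta> \<in> space Pi0 \<Longrightarrow>
                 (\<lambda>n. 1 / real n * (\<integral>\<omega>. ln (R n \<theta> \<omega>) \<partial>P)) \<longlonglongrightarrow> - h \<theta>"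
    and ii_meas: "h \<in> borel_measurable Pi0"
    and ii_fin: "\<bar>ess_inf_on Pi0 (space Pi0) h\<bar> < \<infinity>"
    and iii_meas: "\<And>n. n \<ge> 1 \<Longrightarrow>
                 (\<lambda>\<omega>. SUP \<theta>\<in>space Pi0. ennreal \<bar>1 / real n * ln (R n \<theta> \<omega>) + h \<theta>\<bar>)
                   \<in> borel_measurable (sigma_seg P Xi X n)"
    and iii_conv: "tendsto_zero_in_prob P
                 (\<lambda>n \<omega>. SUP \<theta>\<in>space Pi0. ennreal \<bar>1 / real n * ln (R n \<theta> \<omega>) + h \<theta>\<bar>)"
    and A_meas: "A \<in> sets Pi0"
    and A_pos: "measure Pi0 A > 0"
    and A_gap: "ess_inf_on Pi0 A h > ess_inf_on Pi0 (space Pi0) h"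
  shows "tendsto_zero_in_prob P (\<lambda>n. posterior Pi0 R n A)"
  unfolding tendsto_zero_in_prob_def
proof (intro allI impI)
  interpret P: prob_space P by fact
  interpret Pi0: prob_space Pi0 by fact
  let ?S = "\<lambda>n \<omega>. SUP \<theta>\<in>space Pi0. ennreal \<bar>1 / real n * ln (R n \<theta> \<omega>) + h \<theta>\<bar>"
  fix \<epsilon> :: real assume \<epsilon>: "\<epsilon> > 0"
  obtain b where b: "ess_inf_on Pi0 (space Pi0) h < ereal b" "ereal b < ess_inf_on Pi0 A h"
    using ereal_dense2[OF A_gap] by auto
  obtain a where a: "ess_inf_on Pi0 (space Pi0) h < ereal a" "a < b"
    using ereal_dense2[OF b(1)] by auto
  define p where "p = measure Pi0 {\<theta> \<in> space Pi0. h \<theta> < a}"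
  have p: "p > 0"
    unfolding p_def by (rule Pi0.measure_pos_of_ess_inf_on_less[OF ii_meas a(1)])
  have A_ge: "AE \<theta> in Pi0. \<theta> \<in> A \<longrightarrow> b \<le> h \<theta>"
    using AE_ge_of_less_ess_inf_on[OF b(2)] by simp
  \<comment> \<open>Any \<open>\<delta> < (b - a) / 2\<close> leaves a positive exponential rate; this one leaves exactly \<open>\<delta>\<close>.\<close>
  define \<delta> where "\<delta> = (b - a) / 3"
  have \<delta>: "\<delta> > 0" and rate: "b - a - 2 * \<delta> = \<delta>"
    using a(2) by (auto simp: \<delta>_def field_simps)
  have bound: "posterior Pi0 R n A \<omega> \<le> ennreal (exp (- (real n * \<delta>)) / p)"
    if n: "n \<ge> 1" and \<omega>: "\<omega> \<in> space P" and S: "?S n \<omega> \<le> ennreal \<delta>" for n \<omega>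
  proof -
    have "\<bar>1 / real n * ln (R n \<theta> \<omega>) + h \<theta>\<bar> \<le> \<delta>" if "\<theta> \<in> space Pi0" for \<theta>
      using S that \<delta> by (simp add: SUP_le_iff)
    from posterior_le_exp[where R = R and n = n and \<omega> = \<omega>, 
        OF prior ii_meas n i_pos[OF n _ \<omega>] this A_ge p[unfolded p_def]]
    show ?thesis
      by (simp add: rate p_def)
  qed
  have "(\<lambda>n. exp (- (real n * \<delta>)) / p) \<longlonglongrightarrow> 0"
    using tendsto_divide[OF tendsto_exp_neg_mult_real[OF \<delta>] tendsto_const[of p]] p by simp
  then have "eventually (\<lambda>n. exp (- (real n * \<delta>)) / p < \<epsilon>) sequentially"
    using \<epsilon> by (rule order_tendstoD)
  then have dominated: "eventually (\<lambda>n. measure P {\<omega> \<in> space P. posterior Pi0 R n A \<omega> > ennreal \<epsilon>}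
      \<le> measure P {\<omega> \<in> space P. ?S n \<omega> > ennreal \<delta>}) sequentially"
    using eventually_ge_at_top[of 1]
  proof eventually_elim
    case (elim n)
    have "?S n \<in> borel_measurable P"
      using X_rv iii_meas[OF elim(2)] by (rule borel_measurable_sigma_seg_imp)
    then have "{\<omega> \<in> space P. ?S n \<omega> > ennreal \<delta>} \<in> sets P"
      by measurable
    moreover have "posterior Pi0 R n A \<omega> \<le> ennreal \<epsilon>" if "\<omega> \<in> space P" "?S n \<omega> \<le> ennreal \<delta>" for \<omega>
      using bound[OF elim(2) that] elim(1) by (meson ennreal_leI less_imp_le order_trans)
    ultimately show ?case
      by (intro P.finite_measure_mono) (auto simp: not_less[symmetric])
  qed
  show "(\<lambda>n. measure P {\<omega> \<in> space P. posterior Pi0 R n A \<omega> > ennreal \<epsilon>}) \<longlonglongrightarrow> 0"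
  proof (rule tendsto_sandwich[OF _ dominated tendsto_const])
    show "(\<lambda>n. measure P {\<omega> \<in> space P. ?S n \<omega> > ennreal \<delta>}) \<longlonglongrightarrow> 0"
      using iii_conv \<delta> unfolding tendsto_zero_in_prob_def by blast
  qed simp
qed

end
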